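(* Let $(L,\cdot)$ be a loop. Then: (a) $L$ is an LC-loop if and only if for all $\alpha,\beta\in\Pi_\lambda(L)$ one has $\alpha^2\beta\in\Pi_\lambda(L)$; (b) $L$ is an RC-loop if and only if for all $\alpha,\beta\in\Pi_\rho(L)$ one has $\alpha^2\beta\in\Pi_\rho(L)$.
   Context: Juxtaposition binds tighter than $\cdot$ (e.g. $x\cdot yz = x(yz)$). A loop $(L,\cdot)$ is an LC-loop if $(xx)(yz)=(x(xy))z$ for all $x,y,z\in L$, and an RC-loop if $(zy)(xx)=z((yx)x)$ for all $x,y,z\in L$. Maps are written on the right of their arguments and composed from left to right ($x(UV)=(xU)V$). For $x\in L$ the translations $R_x,L_x:L\to L$ are the bijections $yR_x=yx$ and $yL_x=xy$. $\Pi_\lambda(L)=\{L_x: x\in L\}$ and $\Pi_\rho(L)=\{R_x: x\in L\}$. *)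

theory Defs
  imports "HOL-Algebra.Bij"
begin

locale loop =
  fixes L (structure)
  assumes m_closed [intro, simp]:
      "\<lbrakk>x \<in> carrier L; y \<in> carrier L\<rbrakk> \<Longrightarrow> x \<otimes> y \<in> carrier L"
    and one_closed [intro, simp]: "\<one> \<in> carrier L"
    and l_one [simp]: "x \<in> carrier L \<Longrightarrow> \<one> \<otimes> x = x"
    and r_one [simp]: "x \<in> carrier L \<Longrightarrow> x \<otimes> \<one> = x"
    and l_div: "\<lbrakk>a \<in> carrier L; b \<in> carrier L\<rbrakk> \<Longrightarrow> \<exists>!x. x \<in> carrier L \<and> a \<otimes> x = b"
    and r_div: "\<lbrakk>a \<in> carrier L; b \<in> carrier L\<rbrakk> \<Longrightarrow> \<exists>!y. y \<in> carrier L \<and> y \<otimes> a = b"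

locale LC_loop = loop +
  assumes LC: "\<lbrakk>x \<in> carrier L; y \<in> carrier L; z \<in> carrier L\<rbrakk>
    \<Longrightarrow> (x \<otimes> x) \<otimes> (y \<otimes> z) = (x \<otimes> (x \<otimes> y)) \<otimes> z"

locale RC_loop = loop +
  assumes RC: "\<lbrakk>x \<in> carrier L; y \<in> carrier L; z \<in> carrier L\<rbrakk>
    \<Longrightarrow> (z \<otimes> y) \<otimes> (x \<otimes> x) = z \<otimes> ((y \<otimes> x) \<otimes> x)"

text \<open>Maps on the carrier are extensional functions, as in \<^theory>\<open>HOL-Algebra.Bij\<close>, so that
  equality of maps is equality on the carrier.\<close>

definition left_translation :: "('a, 'm) monoid_scheme \<Rightarrow> 'a \<Rightarrow> 'a \<Rightarrow> 'a"
  where "left_translation L x = (\<lambda>y\<in>carrier L. x \<otimes>\<^bsub>L\<^esub> y)"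

definition right_translation :: "('a, 'm) monoid_scheme \<Rightarrow> 'a \<Rightarrow> 'a \<Rightarrow> 'a"
  where "right_translation L x = (\<lambda>y\<in>carrier L. y \<otimes>\<^bsub>L\<^esub> x)"

definition Pi_lambda :: "('a, 'm) monoid_scheme \<Rightarrow> ('a \<Rightarrow> 'a) set"
  where "Pi_lambda L = left_translation L ` carrier L"

definition Pi_rho :: "('a, 'm) monoid_scheme \<Rightarrow> ('a \<Rightarrow> 'a) set"
  where "Pi_rho L = right_translation L ` carrier L"

text \<open>The product of maps written on the right of their arguments: first \<open>U\<close>, then \<open>V\<close>.
  Note the swap with respect to \<^const>\<open>compose\<close>.\<close>

definition trans_prod :: "('a, 'm) monoid_scheme \<Rightarrow> ('a \<Rightarrow> 'a) \<Rightarrow> ('a \<Rightarrow> 'a) \<Rightarrow> 'a \<Rightarrow> 'a"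
  where "trans_prod L U V = compose (carrier L) V U"

lemma (in loop) left_translation_Bij:
  assumes "x \<in> carrier L"
  shows "left_translation L x \<in> Bij (carrier L)"
proof -
  have "bij_betw (left_translation L x) (carrier L) (carrier L)"
    unfolding bij_betw_def inj_on_def left_translation_def
    using assms l_div[OF assms] by (auto simp: image_iff) metis+
  then show ?thesis
    by (simp add: Bij_def left_translation_def)
qed

lemma (in loop) right_translation_Bij:
  assumes "x \<in> carrier L"
  shows "right_translation L x \<in> Bij (carrier L)"
proof -
  have "bij_betw (right_translation L x) (carrier L) (carrier L)"
    unfolding bij_betw_def inj_on_def right_translation_def
    using assms r_div[OF assms] by (auto simp: image_iff) metis+
  then show ?thesis
    by (simp add: Bij_def right_translation_def)
qed

end

theory Submission
  imports Defs
begin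

text \<open>
  With \<open>\<circ>\<close> denoting composition of functions, the closure condition of the theorem says that
  \<open>\<beta> \<circ> \<alpha> \<circ> \<alpha>\<close> is a translation whenever \<open>\<alpha>\<close> and \<open>\<beta>\<close> are; for left translations it amounts to
  the identity \<open>y(x(xz)) = (y(xx))z\<close>. The LC and RC laws speak about the opposite order: each of
  them says that \<open>\<alpha> \<circ> \<alpha> \<circ> \<beta>\<close> is a translation, which for left translations is the identity
  \<open>x(x(yz)) = (x(xy))z\<close>. This is seen by setting one variable to \<open>\<one>\<close>, since a translation is
  determined by its value at \<open>\<one>\<close>.

  The content of the theorem is that the order does not matter. The reason is that either closure
  condition makes the set \<open>P\<close> of translations closed under inverses, and inversion in the
  group of permutations reverses products: \<open>\<beta>\<alpha>\<alpha>\<close> is the inverse of \<open>\<alpha>\<inverse>\<alpha>\<inverse>\<beta>\<inverse>\<close>.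
  Closure under inverses comes from sharp transitivity. Given \<open>a \<in> P\<close>, choose \<open>b \<in> P\<close> such
  that \<open>aab\<close> (or \<open>baa\<close>, according to the condition) fixes a point; as this product lies in \<open>P\<close>,
  it is the identity, so that \<open>b = a\<^sup>-\<^sup>2\<close>. Now \<open>a\<inverse>\<close> is \<open>aa(bba)\<close>, and also \<open>(abb)aa\<close>.

  This argument only uses that \<open>P\<close> is a sharply transitive set of permutations containing the
  identity, so it serves left and right translations alike.
\<close>

section \<open>Subsets of a group closed under multiplication by squares\<close>

text \<open>If \<open>b = a\<^sup>-\<^sup>2\<close>, then \<open>a\<^sup>-\<^sup>1 = a\<^sup>2 (b\<^sup>2 a)\<close>: two uses of the closure condition.\<close>

lemma (in group) inv_mem_if_left_square_closed:
  assumes P: "P \<subseteq> carrier G"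
    and closed: "\<And>a b. \<lbrakk>a \<in> P; b \<in> P\<rbrakk> \<Longrightarrow> a \<otimes> a \<otimes> b \<in> P"
    and a: "a \<in> P" and b: "b \<in> P" and ab: "a \<otimes> a \<otimes> b = \<one>"
  shows "inv a \<in> P"
proof -
  have car: "a \<in> carrier G" "b \<in> carrier G" using P a b by auto
  have b_eq: "b = inv a \<otimes> inv a"
    using inv_equality[OF ab car(2)] inv_inv[OF car(2)] car by (simp add: inv_mult_group)
  have "a \<otimes> a \<otimes> (b \<otimes> b \<otimes> a) = (a \<otimes> a \<otimes> b) \<otimes> (b \<otimes> a)"
    using car by (simp add: m_assoc)
  also have "\<dots> = inv a"
    using car ab by (simp add: b_eq m_assoc)
  finally show ?thesis
    using closed a b by metis
qed

text \<open>The mirror image of the previous lemma, with \<open>a\<^sup>-\<^sup>1 = (a b\<^sup>2) a\<^sup>2\<close>.\<close>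

lemma (in group) inv_mem_if_right_square_closed:
  assumes P: "P \<subseteq> carrier G"
    and closed: "\<And>a b. \<lbrakk>a \<in> P; b \<in> P\<rbrakk> \<Longrightarrow> b \<otimes> (a \<otimes> a) \<in> P"
    and a: "a \<in> P" and b: "b \<in> P" and ba: "b \<otimes> (a \<otimes> a) = \<one>"
  shows "inv a \<in> P"
proof -
  have car: "a \<in> carrier G" "b \<in> carrier G" using P a b by auto
  have b_eq: "b = inv a \<otimes> inv a"
    using inv_equality[OF ba] car by (simp add: inv_mult_group)
  have "(a \<otimes> (b \<otimes> b)) \<otimes> (a \<otimes> a) = (a \<otimes> b) \<otimes> (b \<otimes> (a \<otimes> a))"
    using car by (simp add: m_assoc)
  also have "\<dots> = inv a"
    using car unfolding ba by (simp add: b_eq m_assoc[symmetric])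
  finally show ?thesis
    using closed a b by metis
qed

lemma (in group) square_closed_swap_if_inv_closed:
  assumes P: "P \<subseteq> carrier G" and inv_closed_P: "\<And>a. a \<in> P \<Longrightarrow> inv a \<in> P"
  shows "(\<forall>a\<in>P. \<forall>b\<in>P. a \<otimes> a \<otimes> b \<in> P) \<longleftrightarrow> (\<forall>a\<in>P. \<forall>b\<in>P. b \<otimes> (a \<otimes> a) \<in> P)"
proof -
  have car: "a \<in> carrier G" if "a \<in> P" for a using P that by auto
  have eq1: "b \<otimes> (a \<otimes> a) = inv (inv a \<otimes> inv a \<otimes> inv b)" if "a \<in> P" "b \<in> P" for a b
    using that by (simp add: inv_mult_group car)
  have eq2: "a \<otimes> a \<otimes> b = inv (inv b \<otimes> (inv a \<otimes> inv a))" if "a \<in> P" "b \<in> P" for a b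
    using that by (simp add: inv_mult_group car)
  show ?thesis
    using eq1 eq2 inv_closed_P by metis
qed

section \<open>Sharply transitive sets of permutations\<close>

definition sharply_transitive_on :: "'a set \<Rightarrow> ('a \<Rightarrow> 'a) set \<Rightarrow> bool"
  where "sharply_transitive_on S P \<longleftrightarrow> (\<forall>p\<in>S. \<forall>q\<in>S. \<exists>!f. f \<in> P \<and> f p = q)"

lemma BijGroup_mult_apply:
  assumes "f \<in> Bij S" "g \<in> Bij S" "p \<in> S"
  shows "(f \<otimes>\<^bsub>BijGroup S\<^esub> g) p = f (g p)"
  using assms by (simp add: BijGroup_def compose_def)

lemma BijGroup_one_apply: "p \<in> S \<Longrightarrow> \<one>\<^bsub>BijGroup S\<^esub> p = p"
  by (simp add: BijGroup_def)

lemma Bij_apply_mem: "\<lbrakk>f \<in> Bij S; p \<in> S\<rbrakk> \<Longrightarrow> f p \<in> S"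
  by (auto simp: Bij_def bij_betw_def)

lemma sharply_transitive_fixed_point_imp_one:
  assumes "sharply_transitive_on S P" "\<one>\<^bsub>BijGroup S\<^esub> \<in> P" "f \<in> P" "e \<in> S" "f e = e"
  shows "f = \<one>\<^bsub>BijGroup S\<^esub>"
  using assms BijGroup_one_apply[of e S] unfolding sharply_transitive_on_def by metis

text \<open>
  Under either closure condition, transitivity supplies the inverse of the square of \<open>a\<close>: it
  is the element of \<open>P\<close> that undoes the square at one chosen point \<open>e\<close>.
\<close>

lemma sharply_transitive_square_closed_swap:
  fixes S :: "'a set"
  defines "G \<equiv> BijGroup S"
  assumes P: "P \<subseteq> Bij S" and st: "sharply_transitive_on S P"
    and one: "\<one>\<^bsub>G\<^esub> \<in> P" and e: "e \<in> S"
  shows "(\<forall>a\<in>P. \<forall>b\<in>P. a \<otimes>\<^bsub>G\<^esub> a \<otimes>\<^bsub>G\<^esub> b \<in> P) \<longleftrightarrow>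
    (\<forall>a\<in>P. \<forall>b\<in>P. b \<otimes>\<^bsub>G\<^esub> (a \<otimes>\<^bsub>G\<^esub> a) \<in> P)" (is "?left \<longleftrightarrow> ?right")
proof -
  interpret G: group G unfolding G_def by (rule group_BijGroup)
  have car: "carrier G = Bij S" by (simp add: G_def BijGroup_def)
  have PG: "P \<subseteq> carrier G" using P car by simp
  have square: "a \<otimes>\<^bsub>G\<^esub> a \<in> Bij S" if "a \<in> P" for a
    using that PG G.m_closed car by blast
  have fix_one: "f = \<one>\<^bsub>G\<^esub>" if "f \<in> P" "f e = e" for f
    using sharply_transitive_fixed_point_imp_one[OF st _ that(1) e that(2)] one
    by (simp add: G_def)
  have swap: "?left \<longleftrightarrow> ?right" if "\<And>a. a \<in> P \<Longrightarrow> inv\<^bsub>G\<^esub> a \<in> P"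
    using G.square_closed_swap_if_inv_closed[OF PG that] .
  have inv_left: "inv\<^bsub>G\<^esub> a \<in> P" if L: ?left and a: "a \<in> P" for a
  proof -
    have "e \<in> (a \<otimes>\<^bsub>G\<^esub> a) ` S"
      using square[OF a] e by (auto simp: Bij_def bij_betw_def)
    then obtain p where p: "p \<in> S" "(a \<otimes>\<^bsub>G\<^esub> a) p = e" by auto
    obtain b where b: "b \<in> P" "b e = p"
      using st e p(1) unfolding sharply_transitive_on_def by blast
    have "(a \<otimes>\<^bsub>G\<^esub> a \<otimes>\<^bsub>G\<^esub> b) e = e"
      using BijGroup_mult_apply[of "a \<otimes>\<^bsub>G\<^esub> a" S b e] square[OF a] b P e p
      by (auto simp: G_def)
    then have "a \<otimes>\<^bsub>G\<^esub> a \<otimes>\<^bsub>G\<^esub> b = \<one>\<^bsub>G\<^esub>"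
      using fix_one L a b by blast
    then show ?thesis
      using G.inv_mem_if_left_square_closed[OF PG _ a b(1)] L by blast
  qed
  have inv_right: "inv\<^bsub>G\<^esub> a \<in> P" if R: ?right and a: "a \<in> P" for a
  proof -
    obtain b where b: "b \<in> P" "b ((a \<otimes>\<^bsub>G\<^esub> a) e) = e"
      using st e Bij_apply_mem[OF square[OF a] e] unfolding sharply_transitive_on_def by blast
    have "(b \<otimes>\<^bsub>G\<^esub> (a \<otimes>\<^bsub>G\<^esub> a)) e = e"
      using BijGroup_mult_apply[of b S "a \<otimes>\<^bsub>G\<^esub> a" e] square[OF a] b P e
      by (auto simp: G_def)
    then have "b \<otimes>\<^bsub>G\<^esub> (a \<otimes>\<^bsub>G\<^esub> a) = \<one>\<^bsub>G\<^esub>"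
      using fix_one R a b by blast
    then show ?thesis
      using G.inv_mem_if_right_square_closed[OF PG _ a b(1)] R by blast
  qed
  show ?thesis
    using swap inv_left inv_right by blast
qed

section \<open>Translations of a loop\<close>

context loop
begin

lemma Pi_lambda_subset_Bij: "Pi_lambda L \<subseteq> Bij (carrier L)"
  by (auto simp: Pi_lambda_def left_translation_Bij)

lemma Pi_rho_subset_Bij: "Pi_rho L \<subseteq> Bij (carrier L)"
  by (auto simp: Pi_rho_def right_translation_Bij)

lemma one_mem_Pi_lambda: "\<one>\<^bsub>BijGroup (carrier L)\<^esub> \<in> Pi_lambda L"
proof -
  have "\<one>\<^bsub>BijGroup (carrier L)\<^esub> = left_translation L \<one>"
    by (auto simp: BijGroup_def left_translation_def)
  then show ?thesis by (simp add: Pi_lambda_def)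
qed

lemma one_mem_Pi_rho: "\<one>\<^bsub>BijGroup (carrier L)\<^esub> \<in> Pi_rho L"
proof -
  have "\<one>\<^bsub>BijGroup (carrier L)\<^esub> = right_translation L \<one>"
    by (auto simp: BijGroup_def right_translation_def)
  then show ?thesis by (simp add: Pi_rho_def)
qed

text \<open>
  Left translations are parametrised by the left factor, so it is division on the right that
  makes them sharply transitive, and conversely for right translations.
\<close>

lemma sharply_transitive_Pi_lambda: "sharply_transitive_on (carrier L) (Pi_lambda L)"
  unfolding sharply_transitive_on_def
proof (intro ballI)
  fix p q assume pq: "p \<in> carrier L" "q \<in> carrier L"
  then obtain x where x: "x \<in> carrier L" "x \<otimes> p = q"
    and unique: "\<And>y. \<lbrakk>y \<in> carrier L; y \<otimes> p = q\<rbrakk> \<Longrightarrow> y = x"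
    using r_div[OF pq] by blast
  show "\<exists>!f. f \<in> Pi_lambda L \<and> f p = q"
  proof (rule ex1I[of _ "left_translation L x"])
    show "left_translation L x \<in> Pi_lambda L \<and> left_translation L x p = q"
      using x pq(1) by (simp add: Pi_lambda_def left_translation_def)
  next
    fix f assume f: "f \<in> Pi_lambda L \<and> f p = q"
    then obtain y where y: "y \<in> carrier L" "f = left_translation L y"
      by (auto simp: Pi_lambda_def)
    then show "f = left_translation L x"
      using unique[OF y(1)] f pq(1) by (simp add: left_translation_def)
  qed
qed

lemma sharply_transitive_Pi_rho: "sharply_transitive_on (carrier L) (Pi_rho L)"
  unfolding sharply_transitive_on_def
proof (intro ballI)
  fix p q assume pq: "p \<in> carrier L" "q \<in> carrier L"
  then obtain x where x: "x \<in> carrier L" "p \<otimes> x = q"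
    and unique: "\<And>y. \<lbrakk>y \<in> carrier L; p \<otimes> y = q\<rbrakk> \<Longrightarrow> y = x"
    using l_div[OF pq] by blast
  show "\<exists>!f. f \<in> Pi_rho L \<and> f p = q"
  proof (rule ex1I[of _ "right_translation L x"])
    show "right_translation L x \<in> Pi_rho L \<and> right_translation L x p = q"
      using x pq(1) by (simp add: Pi_rho_def right_translation_def)
  next
    fix f assume f: "f \<in> Pi_rho L \<and> f p = q"
    then obtain y where y: "y \<in> carrier L" "f = right_translation L y"
      by (auto simp: Pi_rho_def)
    then show "f = right_translation L x"
      using unique[OF y(1)] f pq(1) by (simp add: right_translation_def)
  qed
qed

lemma square_mult_left_translation_apply:
  assumes "x \<in> carrier L" "y \<in> carrier L" "z \<in> carrier L"
  defines "G \<equiv> BijGroup (carrier L)"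
  shows "(left_translation L x \<otimes>\<^bsub>G\<^esub> left_translation L x \<otimes>\<^bsub>G\<^esub> left_translation L y) z
    = x \<otimes> (x \<otimes> (y \<otimes> z))"
  using assms group.is_monoid[OF group_BijGroup, THEN monoid.m_closed,
      of "left_translation L x" "carrier L" "left_translation L x"]
  by (simp add: G_def BijGroup_mult_apply left_translation_Bij BijGroup_def compose_def)
     (simp add: left_translation_def)

lemma square_mult_right_translation_apply:
  assumes "x \<in> carrier L" "y \<in> carrier L" "z \<in> carrier L"
  defines "G \<equiv> BijGroup (carrier L)"
  shows "(right_translation L x \<otimes>\<^bsub>G\<^esub> right_translation L x \<otimes>\<^bsub>G\<^esub> right_translation L y) z
    = ((z \<otimes> y) \<otimes> x) \<otimes> x"
  using assms group.is_monoid[OF group_BijGroup, THEN monoid.m_closed,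
      of "right_translation L x" "carrier L" "right_translation L x"]
  by (simp add: G_def BijGroup_mult_apply right_translation_Bij BijGroup_def compose_def)
     (simp add: right_translation_def)

lemma mem_Pi_lambda_iff:
  assumes "f \<in> Bij (carrier L)"
  shows "f \<in> Pi_lambda L \<longleftrightarrow> (\<forall>z\<in>carrier L. f z = f \<one> \<otimes> z)"
proof
  assume "f \<in> Pi_lambda L"
  then show "\<forall>z\<in>carrier L. f z = f \<one> \<otimes> z"
    by (auto simp: Pi_lambda_def left_translation_def)
next
  assume *: "\<forall>z\<in>carrier L. f z = f \<one> \<otimes> z"
  have "f = left_translation L (f \<one>)"
  proof (rule extensionalityI[of _ "carrier L"])
    show "f \<in> extensional (carrier L)"
      using assms by (simp add: Bij_def)
    show "left_translation L (f \<one>) \<in> extensional (carrier L)"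
      by (simp add: left_translation_def)
    show "f z = left_translation L (f \<one>) z" if "z \<in> carrier L" for z
      unfolding left_translation_def restrict_apply'[OF that] by (rule bspec[OF * that])
  qed
  then show "f \<in> Pi_lambda L"
    unfolding Pi_lambda_def using Bij_apply_mem[OF assms one_closed] by blast
qed

lemma mem_Pi_rho_iff:
  assumes "f \<in> Bij (carrier L)"
  shows "f \<in> Pi_rho L \<longleftrightarrow> (\<forall>z\<in>carrier L. f z = z \<otimes> f \<one>)"
proof
  assume "f \<in> Pi_rho L"
  then show "\<forall>z\<in>carrier L. f z = z \<otimes> f \<one>"
    by (auto simp: Pi_rho_def right_translation_def)
next
  assume *: "\<forall>z\<in>carrier L. f z = z \<otimes> f \<one>"
  have "f = right_translation L (f \<one>)"
  proof (rule extensionalityI[of _ "carrier L"])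
    show "f \<in> extensional (carrier L)"
      using assms by (simp add: Bij_def)
    show "right_translation L (f \<one>) \<in> extensional (carrier L)"
      by (simp add: right_translation_def)
    show "f z = right_translation L (f \<one>) z" if "z \<in> carrier L" for z
      unfolding right_translation_def restrict_apply'[OF that] by (rule bspec[OF * that])
  qed
  then show "f \<in> Pi_rho L"
    unfolding Pi_rho_def using Bij_apply_mem[OF assms one_closed] by blast
qed

lemma BijGroup_square_mult_mem:
  assumes "f \<in> Bij S" "g \<in> Bij S"
  shows "f \<otimes>\<^bsub>BijGroup S\<^esub> f \<otimes>\<^bsub>BijGroup S\<^esub> g \<in> Bij S"
proof -
  interpret group "BijGroup S" by (rule group_BijGroup)
  have "carrier (BijGroup S) = Bij S" by (simp add: BijGroup_def)
  then show ?thesis using assms m_closed by metis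
qed

text \<open>
  The LC law at \<open>z = \<one>\<close>, and the identity on the right at \<open>y = \<one>\<close>, both give the left
  alternative law \<open>(xx)y = x(xy)\<close>, in the presence of which the two identities agree.
\<close>

lemma LC_loop_iff_identity:
  "LC_loop L \<longleftrightarrow> (\<forall>x\<in>carrier L. \<forall>y\<in>carrier L. \<forall>z\<in>carrier L.
     x \<otimes> (x \<otimes> (y \<otimes> z)) = (x \<otimes> (x \<otimes> y)) \<otimes> z)"
proof
  assume "LC_loop L"
  then interpret LC_loop L .
  have alt: "(x \<otimes> x) \<otimes> y = x \<otimes> (x \<otimes> y)" if "x \<in> carrier L" "y \<in> carrier L" for x y
    using LC[of x y \<one>] that by simp
  show "\<forall>x\<in>carrier L. \<forall>y\<in>carrier L. \<forall>z\<in>carrier L.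
     x \<otimes> (x \<otimes> (y \<otimes> z)) = (x \<otimes> (x \<otimes> y)) \<otimes> z"
    using LC alt m_closed by metis
next
  assume *: "\<forall>x\<in>carrier L. \<forall>y\<in>carrier L. \<forall>z\<in>carrier L.
     x \<otimes> (x \<otimes> (y \<otimes> z)) = (x \<otimes> (x \<otimes> y)) \<otimes> z"
  have alt: "(x \<otimes> x) \<otimes> z = x \<otimes> (x \<otimes> z)" if "x \<in> carrier L" "z \<in> carrier L" for x z
    using *[rule_format, of x \<one> z] that by simp
  show "LC_loop L"
    by unfold_locales (simp add: alt *)
qed

lemma RC_loop_iff_identity:
  "RC_loop L \<longleftrightarrow> (\<forall>x\<in>carrier L. \<forall>y\<in>carrier L. \<forall>z\<in>carrier L.
     ((z \<otimes> y) \<otimes> x) \<otimes> x = z \<otimes> ((y \<otimes> x) \<otimes> x))"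
proof
  assume "RC_loop L"
  then interpret RC_loop L .
  have alt: "y \<otimes> (x \<otimes> x) = (y \<otimes> x) \<otimes> x" if "x \<in> carrier L" "y \<in> carrier L" for x y
    using RC[of x y \<one>] that by simp
  show "\<forall>x\<in>carrier L. \<forall>y\<in>carrier L. \<forall>z\<in>carrier L.
     ((z \<otimes> y) \<otimes> x) \<otimes> x = z \<otimes> ((y \<otimes> x) \<otimes> x)"
    using RC alt m_closed by metis
next
  assume *: "\<forall>x\<in>carrier L. \<forall>y\<in>carrier L. \<forall>z\<in>carrier L.
     ((z \<otimes> y) \<otimes> x) \<otimes> x = z \<otimes> ((y \<otimes> x) \<otimes> x)"
  have alt: "z \<otimes> (x \<otimes> x) = (z \<otimes> x) \<otimes> x" if "x \<in> carrier L" "z \<in> carrier L" for x z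
    using *[rule_format, of x \<one> z] that by simp
  show "RC_loop L"
    by unfold_locales (simp add: alt *)
qed

lemma LC_loop_iff_left_square_closed:
  defines "G \<equiv> BijGroup (carrier L)"
  shows "LC_loop L \<longleftrightarrow>
    (\<forall>a\<in>Pi_lambda L. \<forall>b\<in>Pi_lambda L. a \<otimes>\<^bsub>G\<^esub> a \<otimes>\<^bsub>G\<^esub> b \<in> Pi_lambda L)"
proof -
  have "left_translation L x \<otimes>\<^bsub>G\<^esub> left_translation L x \<otimes>\<^bsub>G\<^esub> left_translation L y \<in> Pi_lambda L
      \<longleftrightarrow> (\<forall>z\<in>carrier L. x \<otimes> (x \<otimes> (y \<otimes> z)) = (x \<otimes> (x \<otimes> y)) \<otimes> z)"
    if "x \<in> carrier L" "y \<in> carrier L" for x y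
    using that unfolding G_def
    by (simp add: mem_Pi_lambda_iff BijGroup_square_mult_mem left_translation_Bij
        square_mult_left_translation_apply)
  then show ?thesis
    unfolding LC_loop_iff_identity by (simp add: Pi_lambda_def)
qed

text \<open>
  Composition of functions reverses the factors of a product of right translations, so the RC
  law has the same shape as the LC law here.
\<close>

lemma RC_loop_iff_left_square_closed:
  defines "G \<equiv> BijGroup (carrier L)"
  shows "RC_loop L \<longleftrightarrow>
    (\<forall>a\<in>Pi_rho L. \<forall>b\<in>Pi_rho L. a \<otimes>\<^bsub>G\<^esub> a \<otimes>\<^bsub>G\<^esub> b \<in> Pi_rho L)"
proof -
  have "right_translation L x \<otimes>\<^bsub>G\<^esub> right_translation L x \<otimes>\<^bsub>G\<^esub> right_translation L y \<in> Pi_rho L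
      \<longleftrightarrow> (\<forall>z\<in>carrier L. ((z \<otimes> y) \<otimes> x) \<otimes> x = z \<otimes> ((y \<otimes> x) \<otimes> x))"
    if "x \<in> carrier L" "y \<in> carrier L" for x y
    using that unfolding G_def
    by (simp add: mem_Pi_rho_iff BijGroup_square_mult_mem right_translation_Bij
        square_mult_right_translation_apply)
  then show ?thesis
    unfolding RC_loop_iff_identity by (simp add: Pi_rho_def)
qed

end

lemma trans_prod_square_eq_BijGroup_mult:
  assumes "f \<in> Bij (carrier L)" "g \<in> Bij (carrier L)"
  shows "trans_prod L (trans_prod L f f) g =
    g \<otimes>\<^bsub>BijGroup (carrier L)\<^esub> (f \<otimes>\<^bsub>BijGroup (carrier L)\<^esub> f)"
  using assms by (simp add: trans_prod_def BijGroup_def compose_Bij)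

theorem theorem3p1:
  fixes L :: "('a, 'm) monoid_scheme"
  assumes "loop L"
  shows "(LC_loop L \<longleftrightarrow>
           (\<forall>\<alpha>\<in>Pi_lambda L. \<forall>\<beta>\<in>Pi_lambda L. trans_prod L (trans_prod L \<alpha> \<alpha>) \<beta> \<in> Pi_lambda L))
       \<and> (RC_loop L \<longleftrightarrow>
           (\<forall>\<alpha>\<in>Pi_rho L. \<forall>\<beta>\<in>Pi_rho L. trans_prod L (trans_prod L \<alpha> \<alpha>) \<beta> \<in> Pi_rho L))"
proof -
  interpret loop L by (rule assms)
  have product: "(\<forall>a\<in>P. \<forall>b\<in>P. trans_prod L (trans_prod L a a) b \<in> P) \<longleftrightarrow>
      (\<forall>a\<in>P. \<forall>b\<in>P. b \<otimes>\<^bsub>BijGroup (carrier L)\<^esub> (a \<otimes>\<^bsub>BijGroup (carrier L)\<^esub> a) \<in> P)"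
    if "P \<subseteq> Bij (carrier L)" for P
    using that by (auto simp: trans_prod_square_eq_BijGroup_mult subset_iff)
  show ?thesis
    unfolding product[OF Pi_lambda_subset_Bij] product[OF Pi_rho_subset_Bij]
      LC_loop_iff_left_square_closed RC_loop_iff_left_square_closed
    using sharply_transitive_square_closed_swap[OF Pi_lambda_subset_Bij
        sharply_transitive_Pi_lambda one_mem_Pi_lambda one_closed]
      sharply_transitive_square_closed_swap[OF Pi_rho_subset_Bij
        sharply_transitive_Pi_rho one_mem_Pi_rho one_closed]
    by blast
qed

end
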